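(* Let $G\leq\operatorname{Aut}(T)$ be a self-replicating branch group and let $W$ be a weakly maximal subgroup of $G$. Then for every vertex $v$ of $T$ there exists a weakly maximal subgroup $W^v$ of $G$ contained in $\operatorname{Stab}_G(v)$ such that the section of $W^v$ at $v$ is equal to $W$, that is, $\pi_v(W^v)=W$.
   Context: $T$ is a $d$-regular rooted tree (every vertex has $d$ children), $d\ge 2$ an integer, identified with the set of finite words over $\{0,\dots,d-1\}$. $\operatorname{Aut}(T)$ is the group of graph automorphisms fixing the root; $\mathcal L_n$ is the set of vertices of level $n$; $T_v$ is the subtree of descendants of $v$, identified with $T$ by deleting the prefix $v$. For $G\le\operatorname{Aut}(T)$, $\operatorname{Rist}_G(v)$ is the subgroup of elements acting trivially outside $T_v$, and $\operatorname{Rist}_G(\mathcal L_n)=\prod_{v\in\mathcal L_n}\operatorname{Rist}_G(v)$. $G$ is branch if it acts transitively on every $\mathcal L_n$ and $\operatorname{Rist}_G(\mathcal L_n)$ has finite index in $G$ for every $n$. The homomorphism $\pi_v\colon\operatorname{Stab}_{\operatorname{Aut}(T)}(v)\to\operatorname{Aut}(T_v)\cong\operatorname{Aut}(T)$ is the restriction of the action to $T_v$; for a subgroup $H\le\operatorname{Aut}(T)$ its section at $v$ is $\pi_v(\operatorname{Stab}_H(v))$, also written $\pi_v(H)$. $G$ is self-replicating if $\pi_v(\operatorname{Stab}_G(v))=G$ for every vertex $v$. A subgroup is weakly maximal if it is maximal among the subgroups of infinite index of $G$. *)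

theory Defs
  imports "HOL-Algebra.Algebra"
begin

text \<open>The d-regular rooted tree: its vertices are the finite words over \<open>{0, \<dots>, d - 1}\<close>, the root is
  the empty word, and the children of \<open>v\<close> are the words \<open>v @ [i]\<close>.\<close>

definition tree :: "nat \<Rightarrow> nat list set"
  where "tree d = lists {..<d}"

definition tree_adj :: "nat list \<Rightarrow> nat list \<Rightarrow> bool"
  where "tree_adj u v \<longleftrightarrow> (\<exists>i. v = u @ [i]) \<or> (\<exists>i. u = v @ [i])"

definition level :: "nat \<Rightarrow> nat \<Rightarrow> nat list set"
  where "level d n = {v \<in> tree d. length v = n}"

definition subtree :: "nat \<Rightarrow> nat list \<Rightarrow> nat list set"
  where "subtree d v = {v @ w | w. w \<in> tree d}"

definition tree_automorphisms :: "nat \<Rightarrow> (nat list \<Rightarrow> nat list) set"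
  where "tree_automorphisms d =
    {g \<in> Bij (tree d). g [] = [] \<and> (\<forall>u\<in>tree d. \<forall>v\<in>tree d. tree_adj (g u) (g v) \<longleftrightarrow> tree_adj u v)}"

text \<open>The product of this group is composition, \<open>(f \<otimes> g) u = f (g u)\<close>; its elements are
  \<open>undefined\<close> outside the tree.\<close>

definition AutT :: "nat \<Rightarrow> (nat list \<Rightarrow> nat list) monoid"
  where "AutT d = (BijGroup (tree d))\<lparr>carrier := tree_automorphisms d\<rparr>"

text \<open>A subgroup of \<open>AutT d\<close>, given by its underlying set, as a group in its own right.\<close>

abbreviation subgrp :: "nat \<Rightarrow> (nat list \<Rightarrow> nat list) set \<Rightarrow> (nat list \<Rightarrow> nat list) monoid"
  where "subgrp d G \<equiv> (AutT d)\<lparr>carrier := G\<rparr>"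

definition Stab :: "nat \<Rightarrow> (nat list \<Rightarrow> nat list) set \<Rightarrow> nat list \<Rightarrow> (nat list \<Rightarrow> nat list) set"
  where "Stab d G v = stabilizer (subgrp d G) (\<lambda>g. g) v"

definition Rist :: "nat \<Rightarrow> (nat list \<Rightarrow> nat list) set \<Rightarrow> nat list \<Rightarrow> (nat list \<Rightarrow> nat list) set"
  where "Rist d G v = {g \<in> G. \<forall>u \<in> tree d - subtree d v. g u = u}"

text \<open>The subgroups \<open>Rist d G v\<close>, for \<open>v\<close> of a given level, have disjoint supports and so commute
  with each other: their product is the subgroup they generate.\<close>

definition Rist_level :: "nat \<Rightarrow> (nat list \<Rightarrow> nat list) set \<Rightarrow> nat \<Rightarrow> (nat list \<Rightarrow> nat list) set"
  where "Rist_level d G n = generate (subgrp d G) (\<Union>v\<in>level d n. Rist d G v)"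

text \<open>The index is not expressed through \<open>card\<close>, which is 0 on infinite sets.\<close>

definition finite_index :: "'a set \<Rightarrow> ('a, 'b) monoid_scheme \<Rightarrow> bool"
  where "finite_index H G \<longleftrightarrow> finite (rcosets\<^bsub>G\<^esub> H)"

definition weakly_maximal :: "'a set \<Rightarrow> ('a, 'b) monoid_scheme \<Rightarrow> bool"
  where "weakly_maximal W G \<longleftrightarrow>
    subgroup W G \<and> \<not> finite_index W G \<and>
    (\<forall>K. subgroup K G \<and> \<not> finite_index K G \<and> W \<subseteq> K \<longrightarrow> K = W)"

definition branch :: "nat \<Rightarrow> (nat list \<Rightarrow> nat list) set \<Rightarrow> bool"
  where "branch d G \<longleftrightarrow>
    subgroup G (AutT d) \<and>
    (\<forall>n. \<forall>u\<in>level d n. \<forall>v\<in>level d n. \<exists>g\<in>G. g u = v) \<and>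
    (\<forall>n. finite_index (Rist_level d G n) (subgrp d G))"

text \<open>\<open>restr d v\<close> is the homomorphism \<open>\<pi>\<^sub>v\<close>. It is meaningful only on automorphisms \<open>g\<close> fixing \<open>v\<close>:
  then \<open>g (v @ w)\<close> starts with \<open>v\<close>, and dropping \<open>length v\<close> letters deletes that prefix.\<close>

definition restr :: "nat \<Rightarrow> nat list \<Rightarrow> (nat list \<Rightarrow> nat list) \<Rightarrow> (nat list \<Rightarrow> nat list)"
  where "restr d v g = (\<lambda>w\<in>tree d. drop (length v) (g (v @ w)))"

definition tree_section :: "nat \<Rightarrow> (nat list \<Rightarrow> nat list) set \<Rightarrow> nat list \<Rightarrow> (nat list \<Rightarrow> nat list) set"
  where "tree_section d H v = restr d v ` Stab d H v"

definition self_replicating :: "nat \<Rightarrow> (nat list \<Rightarrow> nat list) set \<Rightarrow> bool"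
  where "self_replicating d G \<longleftrightarrow> (\<forall>v\<in>tree d. tree_section d G v = G)"

lemma subgroup_tree_automorphisms: "subgroup (tree_automorphisms d) (BijGroup (tree d))"
proof -
  interpret B: group "BijGroup (tree d)" by (rule group_BijGroup)
  let ?T = "tree d"
  have root: "[] \<in> ?T" by (simp add: tree_def)
  show ?thesis
  proof (rule B.subgroupI)
    show "tree_automorphisms d \<subseteq> carrier (BijGroup ?T)"
      by (auto simp: tree_automorphisms_def BijGroup_def)
    show "tree_automorphisms d \<noteq> {}"
      using id_Bij[of ?T] root by (auto simp: tree_automorphisms_def intro!: exI[of _ "\<lambda>x\<in>?T. x"])
  next
    fix a assume a: "a \<in> tree_automorphisms d"
    then have aB: "a \<in> Bij ?T" and bij: "bij_betw a ?T ?T"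
      by (auto simp: tree_automorphisms_def Bij_def)
    let ?b = "inv_into ?T a"
    have b: "?b x \<in> ?T" "a (?b x) = x" if "x \<in> ?T" for x
      using bij that by (auto simp: bij_betw_def inv_into_into f_inv_into_f)
    have "?b [] = []"
      using a root bij inv_into_f_f[of a ?T "[]"] by (auto simp: tree_automorphisms_def bij_betw_def)
    moreover have "tree_adj (?b u) (?b v) \<longleftrightarrow> tree_adj u v" if "u \<in> ?T" "v \<in> ?T" for u v
      using a b[OF that(1)] b[OF that(2)] unfolding tree_automorphisms_def by force
    ultimately show "inv\<^bsub>BijGroup ?T\<^esub> a \<in> tree_automorphisms d"
      using aB root by (simp add: inv_BijGroup tree_automorphisms_def restrict_inv_into_Bij)
  next
    fix a b assume "a \<in> tree_automorphisms d" "b \<in> tree_automorphisms d"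
    then show "a \<otimes>\<^bsub>BijGroup ?T\<^esub> b \<in> tree_automorphisms d"
      using root Bij_imp_funcset[of b ?T]
      by (auto simp: tree_automorphisms_def BijGroup_def compose_Bij compose_eq Pi_iff)
  qed
qed

lemma group_AutT: "group (AutT d)"
  unfolding AutT_def
  by (rule subgroup.subgroup_is_group[OF subgroup_tree_automorphisms group_BijGroup])

end

theory Submission
  imports Defs
begin

text \<open>Let \<open>W\<^sup>v\<close> consist of the elements of \<open>Stab\<^sub>G(v)\<close> whose section at \<open>v\<close> lies in \<open>W\<close>. Since \<open>\<pi>\<^sub>v\<close> maps
  \<open>Stab\<^sub>G(v)\<close> onto \<open>G\<close>, the index of \<open>W\<^sup>v\<close> in \<open>Stab\<^sub>G(v)\<close> is that of \<open>W\<close> in \<open>G\<close>. Moreover \<open>W\<^sup>v\<close> contains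
  \<open>Rist\<^sub>G(w)\<close> for every other vertex \<open>w\<close> of the level \<open>n\<close> of \<open>v\<close>. If an overgroup \<open>K\<close> of \<open>W\<^sup>v\<close> moves \<open>v\<close>,
  then it also contains a conjugate of one of these, namely \<open>Rist\<^sub>G(v)\<close>, hence all of
  \<open>Rist\<^sub>G(L\<^sub>n)\<close>, and has finite index. Otherwise \<open>K\<close> lies in \<open>Stab\<^sub>G(v)\<close> and is the preimage of
  \<open>\<pi>\<^sub>v(K)\<close>, a subgroup containing \<open>W\<close>, so weak maximality of \<open>W\<close> applies.\<close>

section \<open>Subgroups of finite index\<close>

lemma rcosets_eq_image: "rcosets\<^bsub>G\<^esub> H = (\<lambda>x. H #>\<^bsub>G\<^esub> x) ` carrier G"
  by (auto simp: RCOSETS_def)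

context group
begin

lemma inv_conj_cancel:
  assumes "k \<in> carrier G" "g \<in> carrier G"
  shows "inv k \<otimes> (k \<otimes> g \<otimes> inv k) \<otimes> k = g"
proof -
  have "inv k \<otimes> (k \<otimes> g \<otimes> inv k) \<otimes> k = (inv k \<otimes> k) \<otimes> g \<otimes> (inv k \<otimes> k)"
    using assms by (simp only: m_assoc m_closed inv_closed)
  then show ?thesis using assms by simp
qed

text \<open>Choosing one element in each coset turns finiteness of a set of cosets into a finite set
  of representatives. Representatives, unlike cosets, are easily multiplied, pushed through a
  homomorphism or lifted.\<close>

lemma finite_index_iff_reps:
  assumes "subgroup H G"
  shows "finite_index H G \<longleftrightarrow>
    (\<exists>F. finite F \<and> F \<subseteq> carrier G \<and> (\<forall>x\<in>carrier G. \<exists>f\<in>F. x \<in> H #> f))"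
proof
  assume "finite_index H G"
  then obtain F where F: "finite F" "F \<subseteq> carrier G" "rcosets H = (\<lambda>x. H #> x) ` F"
    unfolding finite_index_def rcosets_eq_image by (metis finite_subset_image subset_refl)
  have "\<exists>f\<in>F. x \<in> H #> f" if "x \<in> carrier G" for x
  proof -
    have "H #> x \<in> (\<lambda>x. H #> x) ` F"
      using that F(3) rcosetsI[OF subgroup.subset[OF assms]] by blast
    then show ?thesis
      using rcos_self[OF that assms] by auto
  qed
  with F(1,2) show "\<exists>F. finite F \<and> F \<subseteq> carrier G \<and> (\<forall>x\<in>carrier G. \<exists>f\<in>F. x \<in> H #> f)"
    by (intro exI[of _ F] conjI ballI)
next
  assume "\<exists>F. finite F \<and> F \<subseteq> carrier G \<and> (\<forall>x\<in>carrier G. \<exists>f\<in>F. x \<in> H #> f)"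
  then obtain F where F: "finite F" "F \<subseteq> carrier G" "\<forall>x\<in>carrier G. \<exists>f\<in>F. x \<in> H #> f"
    by blast
  have "rcosets H \<subseteq> (\<lambda>x. H #> x) ` F"
  proof
    fix c assume "c \<in> rcosets H"
    then obtain x where x: "x \<in> carrier G" "c = H #> x"
      by (auto simp: RCOSETS_def)
    with F obtain f where "f \<in> F" "x \<in> H #> f" by blast
    with x F(2) show "c \<in> (\<lambda>x. H #> x) ` F"
      using repr_independence[OF _ _ assms, of x f] by blast
  qed
  with F(1) show "finite_index H G"
    unfolding finite_index_def by (meson finite_imageI finite_subset)
qed

lemma finite_index_mono:
  assumes "subgroup H G" "subgroup K G" "H \<subseteq> K" "finite_index H G"
  shows "finite_index K G"
proof -
  have "H #> f \<subseteq> K #> f" for f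
    using assms(3) by (auto simp: r_coset_def)
  then show ?thesis
    using assms(4) unfolding finite_index_iff_reps[OF assms(1)] finite_index_iff_reps[OF assms(2)]
    by (metis subsetD)
qed

text \<open>Changing the carrier leaves the product alone, so the cosets of \<open>H\<close> by
  elements of \<open>K\<close> are some of its cosets by elements of \<open>G\<close>.\<close>

lemma finite_index_restrict:
  assumes "subgroup K G" "finite_index H G"
  shows "finite_index H (G\<lparr>carrier := K\<rparr>)"
proof -
  have "(\<lambda>x. H #> x) ` K \<subseteq> (\<lambda>x. H #> x) ` carrier G"
    by (rule image_mono[OF subgroup.subset[OF assms(1)]])
  then have "finite ((\<lambda>x. H #> x) ` K)"
    using assms(2) unfolding finite_index_def rcosets_eq_image by (rule finite_subset)
  then show ?thesis
    by (simp add: finite_index_def rcosets_eq_image r_coset_def)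
qed

text \<open>If \<open>a\<close> runs through representatives of \<open>H\<close> in \<open>K\<close>
  and \<open>b\<close> through those of \<open>K\<close> in \<open>G\<close>, the products
  \<open>a \<otimes> b\<close> represent \<open>H\<close> in \<open>G\<close>:
  \<open>x = k \<otimes> b\<close> and \<open>k = h \<otimes> a\<close>.\<close>

lemma finite_index_trans:
  assumes H: "subgroup H (G\<lparr>carrier := K\<rparr>)" and K: "subgroup K G"
    and fin: "finite_index H (G\<lparr>carrier := K\<rparr>)" "finite_index K G"
  shows "finite_index H G"
proof -
  interpret K: group "G\<lparr>carrier := K\<rparr>" by (rule subgroup_imp_group[OF K])
  have HG: "subgroup H G" by (rule incl_subgroup[OF K H])
  have sub: "K \<subseteq> carrier G" "H \<subseteq> carrier G"
    using K HG by (auto dest: subgroup.subset)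
  obtain F1 where F1: "finite F1" "F1 \<subseteq> K" "\<forall>x\<in>K. \<exists>f\<in>F1. x \<in> H #> f"
    using fin(1) unfolding K.finite_index_iff_reps[OF H] by (auto simp: r_coset_def)
  obtain F2 where F2: "finite F2" "F2 \<subseteq> carrier G" "\<forall>x\<in>carrier G. \<exists>f\<in>F2. x \<in> K #> f"
    using fin(2) unfolding finite_index_iff_reps[OF K] by blast
  let ?F = "(\<lambda>(a, b). a \<otimes> b) ` (F1 \<times> F2)"
  have "finite ?F" using F1 F2 by simp
  moreover have "?F \<subseteq> carrier G" using F1(2) F2(2) sub(1) by (fastforce simp: subset_iff)
  moreover have "\<exists>f\<in>?F. x \<in> H #> f" if x: "x \<in> carrier G" for x
  proof -
    obtain b k where b: "b \<in> F2" "k \<in> K" "x = k \<otimes> b"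
      using F2(3) x unfolding r_coset_def by blast
    obtain a h where a: "a \<in> F1" "h \<in> H" "k = h \<otimes> a"
      using F1(3) b(2) unfolding r_coset_def by blast
    have "x = h \<otimes> (a \<otimes> b)"
      using a b F1(2) F2(2) sub by (simp add: m_assoc subset_iff)
    with a b show ?thesis unfolding r_coset_def by blast
  qed
  ultimately show ?thesis
    unfolding finite_index_iff_reps[OF HG] by (intro exI[of _ ?F] conjI ballI)
qed

end

section \<open>Preimages of subgroups under homomorphisms\<close>

context group_hom
begin

lemma subgroup_vimage:
  assumes "subgroup W H"
  shows "subgroup {x \<in> carrier G. h x \<in> W} G"
proof (rule G.subgroupI)
  have "\<one> \<in> {x \<in> carrier G. h x \<in> W}"
    using subgroup.one_closed[OF assms] by simp
  then show "{x \<in> carrier G. h x \<in> W} \<noteq> {}" by blast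
qed (simp_all add: subgroup.m_closed[OF assms] subgroup.m_inv_closed[OF assms])

text \<open>Images of representatives represent \<open>W\<close>, and arbitrary lifts of
  representatives of \<open>W\<close> represent the preimage; both directions use
  surjectivity.\<close>

lemma finite_index_vimage_iff:
  assumes surj: "h ` carrier G = carrier H" and W: "subgroup W H"
  shows "finite_index {x \<in> carrier G. h x \<in> W} G \<longleftrightarrow> finite_index W H"
    (is "finite_index ?V G \<longleftrightarrow> _")
proof
  assume "finite_index ?V G"
  then obtain F where F: "finite F" "F \<subseteq> carrier G" "\<forall>x\<in>carrier G. \<exists>f\<in>F. x \<in> ?V #> f"
    unfolding G.finite_index_iff_reps[OF subgroup_vimage[OF W]] by blast
  have "\<exists>f\<in>h ` F. y \<in> W #>\<^bsub>H\<^esub> f" if y: "y \<in> carrier H" for y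
  proof -
    obtain x where x: "x \<in> carrier G" "y = h x" using y surj by blast
    with F obtain f w where "f \<in> F" "w \<in> carrier G" "h w \<in> W" "x = w \<otimes> f"
      unfolding r_coset_def by blast
    with x F(2) have "f \<in> F" "h w \<in> W" "y = h w \<otimes>\<^bsub>H\<^esub> h f" by auto
    then show ?thesis unfolding r_coset_def by blast
  qed
  then show "finite_index W H"
    unfolding H.finite_index_iff_reps[OF W] using F
    by (intro exI[of _ "h ` F"]) auto
next
  assume "finite_index W H"
  then obtain F where F: "finite F" "F \<subseteq> carrier H" "\<forall>x\<in>carrier H. \<exists>f\<in>F. x \<in> W #>\<^bsub>H\<^esub> f"
    unfolding H.finite_index_iff_reps[OF W] by blast
  then obtain E where E: "finite E" "E \<subseteq> carrier G" "F = h ` E"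
    using finite_subset_image[of F h "carrier G"] surj by blast
  have "\<exists>f\<in>E. x \<in> ?V #> f" if x: "x \<in> carrier G" for x
  proof -
    have "h x \<in> carrier H" using x by simp
    then obtain e w where e: "e \<in> E" "w \<in> W" "h x = w \<otimes>\<^bsub>H\<^esub> h e"
      using F(3) E(3) unfolding r_coset_def by blast
    have eG: "e \<in> carrier G" using e E by blast
    have wH: "w \<in> carrier H" using e subgroup.subset[OF W] by blast
    \<comment> \<open>Hence \<open>x \<otimes> inv e\<close> lies in the preimage of
      \<open>W\<close>, and \<open>x\<close> lies in the coset of the lift \<open>e\<close>.\<close>
    have "h (x \<otimes> inv e) = w"
      using x e eG wH by (simp add: H.m_assoc)
    moreover have "x = (x \<otimes> inv e) \<otimes> e"
      using x eG by (simp add: G.m_assoc)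
    ultimately show ?thesis
      using e x eG unfolding r_coset_def by blast
  qed
  then show "finite_index ?V G"
    unfolding G.finite_index_iff_reps[OF subgroup_vimage[OF W]] using E by blast
qed

text \<open>A subgroup containing the kernel is a union of fibres: if \<open>h x = h k\<close> with
  \<open>k\<close> in \<open>K\<close>, then \<open>x \<otimes> inv k\<close> lies in the kernel,
  hence in \<open>K\<close>.\<close>

lemma vimage_image_eq:
  assumes K: "subgroup K G" and ker: "kernel G H h \<subseteq> K"
  shows "{x \<in> carrier G. h x \<in> h ` K} = K"
proof
  have KG: "K \<subseteq> carrier G" by (rule subgroup.subset[OF K])
  show "{x \<in> carrier G. h x \<in> h ` K} \<subseteq> K"
  proof
    fix x assume "x \<in> {x \<in> carrier G. h x \<in> h ` K}"
    then obtain k where x: "x \<in> carrier G" and k: "k \<in> K" "h x = h k" by blast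
    have kG: "k \<in> carrier G" using k KG by blast
    have "x \<otimes> inv k \<in> kernel G H h"
      using x k kG by (simp add: kernel_def)
    then have "(x \<otimes> inv k) \<otimes> k \<in> K"
      using ker k subgroup.m_closed[OF K] by blast
    then show "x \<in> K" using x kG by (simp add: G.m_assoc)
  qed
  show "K \<subseteq> {x \<in> carrier G. h x \<in> h ` K}" using KG by blast
qed

end

section \<open>Automorphisms of the tree\<close>

lemma tree_append_iff [simp]: "u @ w \<in> tree d \<longleftrightarrow> u \<in> tree d \<and> w \<in> tree d"
  by (auto simp: tree_def)

lemma tree_Nil [simp]: "[] \<in> tree d"
  by (simp add: tree_def)

lemma tree_Cons_iff [simp]: "i # w \<in> tree d \<longleftrightarrow> i < d \<and> w \<in> tree d"
  by (auto simp: tree_def)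

lemma tree_automorphism_closed: "g \<in> tree_automorphisms d \<Longrightarrow> u \<in> tree d \<Longrightarrow> g u \<in> tree d"
  by (auto simp: tree_automorphisms_def Bij_def bij_betw_def)

lemma tree_automorphism_inj: "g \<in> tree_automorphisms d \<Longrightarrow> inj_on g (tree d)"
  by (auto simp: tree_automorphisms_def Bij_def bij_betw_def)

lemma tree_automorphism_adj:
  "g \<in> tree_automorphisms d \<Longrightarrow> u \<in> tree d \<Longrightarrow> v \<in> tree d \<Longrightarrow>
    tree_adj (g u) (g v) \<longleftrightarrow> tree_adj u v"
  by (simp add: tree_automorphisms_def)

text \<open>Adjacency is symmetric, so a priori a child could be sent to the parent of
  \<open>g u\<close>. The root has no parent; elsewhere the parent of \<open>g u\<close> is already
  the image of the parent of \<open>u\<close>.\<close>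

lemma tree_automorphism_child:
  assumes g: "g \<in> tree_automorphisms d"
  shows "u @ [i] \<in> tree d \<Longrightarrow> \<exists>j. g (u @ [i]) = g u @ [j]"
proof (induction u arbitrary: i rule: rev_induct)
  case Nil
  have root: "g [] = []"
    using g by (simp add: tree_automorphisms_def)
  have "tree_adj (g []) (g [i])"
    using Nil tree_automorphism_adj[OF g, of "[]" "[i]"] by (simp add: tree_adj_def)
  then show ?case using root by (simp add: tree_adj_def)
next
  case (snoc k u)
  then obtain l where l: "g (u @ [k]) = g u @ [l]" using snoc.IH[of k] by auto
  have "u @ [k] \<in> tree d" "(u @ [k]) @ [i] \<in> tree d" using snoc.prems by simp_all
  then have "tree_adj (g (u @ [k])) (g ((u @ [k]) @ [i]))"
    using tree_automorphism_adj[OF g, of "u @ [k]" "(u @ [k]) @ [i]"] unfolding tree_adj_def by blast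
  \<comment> \<open>By \<open>l\<close>, the vertex \<open>g u\<close> is the parent of
    \<open>g (u @ [k])\<close>; injectivity excludes it.\<close>
  moreover have "g ((u @ [k]) @ [i]) \<noteq> g u"
    using inj_onD[OF tree_automorphism_inj[OF g], of "(u @ [k]) @ [i]" u] snoc.prems by auto
  ultimately show ?case using l by (auto simp: tree_adj_def)
qed

text \<open>This makes \<open>restr\<close> meaningful, since an automorphism fixing
  \<open>v\<close> keeps the prefix \<open>v\<close>; the case \<open>u = []\<close> gives
  preservation of levels.\<close>

lemma tree_automorphism_append:
  assumes g: "g \<in> tree_automorphisms d"
  shows "u @ w \<in> tree d \<Longrightarrow> \<exists>w'. g (u @ w) = g u @ w' \<and> length w' = length w"
proof (induction w rule: rev_induct)
  case (snoc i w)
  then obtain w' where "g (u @ w) = g u @ w'" "length w' = length w" by auto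
  moreover obtain j where "g ((u @ w) @ [i]) = g (u @ w) @ [j]"
    using tree_automorphism_child[OF g, of "u @ w" i] snoc.prems by auto
  ultimately show ?case by simp
qed simp

lemma tree_automorphism_length:
  assumes g: "g \<in> tree_automorphisms d" and "u \<in> tree d"
  shows "length (g u) = length u"
  using tree_automorphism_append[OF g, of "[]" u] assms by (auto simp: tree_automorphisms_def)

lemma subtree_same_level:
  "length u = length v \<Longrightarrow> v @ x \<in> subtree d u \<Longrightarrow> u = v"
  by (auto simp: subtree_def)

section \<open>The group \<open>AutT d\<close>, stabilizers and sections\<close>

lemma carrier_AutT [simp]: "carrier (AutT d) = tree_automorphisms d"
  by (simp add: AutT_def)

lemma one_AutT: "\<one>\<^bsub>AutT d\<^esub> = (\<lambda>u\<in>tree d. u)"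
  by (simp add: AutT_def BijGroup_def)

lemma mult_AutT:
  "g \<in> tree_automorphisms d \<Longrightarrow> h \<in> tree_automorphisms d \<Longrightarrow>
    g \<otimes>\<^bsub>AutT d\<^esub> h = compose (tree d) g h"
  by (simp add: AutT_def BijGroup_def tree_automorphisms_def)

lemma Stab_iff: "g \<in> Stab d G v \<longleftrightarrow> g \<in> G \<and> g v = v"
  by (simp add: Stab_def stabilizer_def)

text \<open>Since \<open>h (v @ w)\<close> again starts with \<open>v\<close>, nothing is lost in
  deleting the prefix before applying \<open>g\<close>. That the sections are automorphisms is
  assumed so that their product is a composition; self-replication will supply it.\<close>

lemma restr_mult:
  assumes "g \<in> tree_automorphisms d" "h \<in> tree_automorphisms d" "v \<in> tree d"
    and "g v = v" "h v = v" "restr d v g \<in> tree_automorphisms d" "restr d v h \<in> tree_automorphisms d"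
  shows "restr d v (g \<otimes>\<^bsub>AutT d\<^esub> h) = restr d v g \<otimes>\<^bsub>AutT d\<^esub> restr d v h"
proof -
  have "restr d v (g \<otimes>\<^bsub>AutT d\<^esub> h) w = compose (tree d) (restr d v g) (restr d v h) w" for w
  proof (cases "w \<in> tree d")
    case True
    then obtain w' where w': "h (v @ w) = v @ w'"
      using tree_automorphism_append[OF assms(2), of v w] assms by auto
    then have "w' \<in> tree d"
      using tree_automorphism_closed[OF assms(2), of "v @ w"] True assms by auto
    with w' True assms show ?thesis
      by (simp add: restr_def mult_AutT compose_def)
  qed (simp add: restr_def compose_def)
  then show ?thesis using assms by (simp add: mult_AutT fun_eq_iff)
qed

lemma subgroup_Stab:
  assumes G: "subgroup G (AutT d)" and v: "v \<in> tree d"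
  shows "subgroup (Stab d G v) (subgrp d G)"
proof -
  interpret A: group "AutT d" by (rule group_AutT)
  interpret G: group "subgrp d G" by (rule A.subgroup_imp_group[OF G])
  have sub: "G \<subseteq> tree_automorphisms d" using subgroup.subset[OF G] by simp
  show ?thesis
  proof (rule G.subgroupI)
    show "Stab d G v \<subseteq> carrier (subgrp d G)" by (auto simp: Stab_iff)
    have "\<one>\<^bsub>AutT d\<^esub> \<in> Stab d G v"
      using subgroup.one_closed[OF G] v by (simp add: Stab_iff one_AutT)
    then show "Stab d G v \<noteq> {}" by blast
  next
    fix a assume a: "a \<in> Stab d G v"
    let ?b = "inv\<^bsub>subgrp d G\<^esub> a"
    have aG: "a \<in> G" and b: "?b \<in> G" using a G.inv_closed[of a] by (auto simp: Stab_iff)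
    \<comment> \<open>Evaluating this identity at \<open>v\<close>, which \<open>a\<close> fixes,
      shows that the inverse fixes \<open>v\<close>.\<close>
    have "?b \<otimes>\<^bsub>AutT d\<^esub> a = \<one>\<^bsub>AutT d\<^esub>" using G.l_inv[of a] aG by simp
    then have "compose (tree d) ?b a v = (\<lambda>u\<in>tree d. u) v"
      using aG b sub by (metis mult_AutT one_AutT subsetD)
    then have "?b v = v" using a v by (simp add: compose_def Stab_iff)
    then show "?b \<in> Stab d G v" using b by (simp add: Stab_iff)
  next
    fix a b assume "a \<in> Stab d G v" "b \<in> Stab d G v"
    moreover from this have "a \<otimes>\<^bsub>AutT d\<^esub> b \<in> G"
      using subgroup.m_closed[OF G] by (simp add: Stab_iff)
    ultimately show "a \<otimes>\<^bsub>subgrp d G\<^esub> b \<in> Stab d G v"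
      using v sub by (auto simp: Stab_iff mult_AutT subset_iff compose_def)
  qed
qed

section \<open>Rigid stabilizers\<close>

lemma Rist_fixes_level:
  assumes G: "G \<subseteq> tree_automorphisms d" and g: "g \<in> Rist d G u"
    and uv: "v \<in> tree d" "length u = length v"
  shows "g v = v"
proof (cases "u = v")
  case False
  then show ?thesis
    using g uv subtree_same_level[of u v "[]" d] by (auto simp: Rist_def)
next
  case True
  have gA: "g \<in> tree_automorphisms d" using g G by (auto simp: Rist_def)
  have gv: "g v \<in> tree d" "length (g v) = length v"
    using tree_automorphism_closed[OF gA] tree_automorphism_length[OF gA] uv by auto
  show ?thesis
  proof (rule ccontr)
    \<comment> \<open>The vertex \<open>g v\<close> has the level of \<open>v\<close>, so it would
      lie outside the subtree at \<open>v\<close> and be fixed by \<open>g\<close>; then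
      \<open>g\<close> would take the same value at \<open>v\<close> and at
      \<open>g v\<close>.\<close>
    assume "g v \<noteq> v"
    then have "g (g v) = g v"
      using g gv True subtree_same_level[of v "g v" "[]" d] by (auto simp: Rist_def)
    then show False
      using inj_onD[OF tree_automorphism_inj[OF gA], of "g v" v] gv uv \<open>g v \<noteq> v\<close> by simp
  qed
qed

text \<open>Distinct vertices of one level have disjoint subtrees, so \<open>g\<close> is trivial
  below \<open>v\<close>.\<close>

lemma restr_Rist:
  assumes "g \<in> Rist d G u" "v \<in> tree d" "length u = length v" "u \<noteq> v"
  shows "restr d v g = \<one>\<^bsub>AutT d\<^esub>"
proof -
  have "g (v @ w) = v @ w" if "w \<in> tree d" for w
    using assms that subtree_same_level[of u v w d] by (auto simp: Rist_def)
  then show ?thesis by (auto simp: restr_def one_AutT restrict_def)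
qed

text \<open>As \<open>k\<close> maps the subtree at \<open>v\<close> into the one at
  \<open>k v\<close>, the inverse of \<open>k\<close> takes a vertex outside the latter to one
  outside the former, where \<open>g\<close> acts trivially.\<close>

lemma Rist_conjugate:
  assumes G: "subgroup G (AutT d)" and k: "k \<in> G" and v: "v \<in> tree d" and g: "g \<in> Rist d G v"
  shows "k \<otimes>\<^bsub>AutT d\<^esub> g \<otimes>\<^bsub>AutT d\<^esub> inv\<^bsub>AutT d\<^esub> k \<in> Rist d G (k v)"
proof -
  interpret A: group "AutT d" by (rule group_AutT)
  let ?i = "inv\<^bsub>AutT d\<^esub> k"
  have gG: "g \<in> G" using g by (simp add: Rist_def)
  have iG: "?i \<in> G" by (rule subgroup.m_inv_closed[OF G k])
  have kgG: "k \<otimes>\<^bsub>AutT d\<^esub> g \<in> G" by (rule subgroup.m_closed[OF G k gG])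
  have aut: "x \<in> tree_automorphisms d" if "x \<in> G" for x
    using subgroup.subset[OF G] that by auto
  have "k \<otimes>\<^bsub>AutT d\<^esub> ?i = \<one>\<^bsub>AutT d\<^esub>" using A.r_inv aut[OF k] by simp
  then have ki: "compose (tree d) k ?i = (\<lambda>u\<in>tree d. u)"
    by (simp add: mult_AutT[OF aut[OF k] aut[OF iG]] one_AutT)
  have "(k \<otimes>\<^bsub>AutT d\<^esub> g \<otimes>\<^bsub>AutT d\<^esub> ?i) u = u" if u: "u \<in> tree d" "u \<notin> subtree d (k v)" for u
  proof -
    have iu: "?i u \<in> tree d" by (rule tree_automorphism_closed[OF aut[OF iG] u(1)])
    have kiu: "k (?i u) = u" using fun_cong[OF ki, of u] u by (simp add: compose_def)
    have "?i u \<notin> subtree d v"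
    proof
      assume "?i u \<in> subtree d v"
      then obtain w where w: "?i u = v @ w" "w \<in> tree d" by (auto simp: subtree_def)
      then obtain w' where w': "k (v @ w) = k v @ w'"
        using tree_automorphism_append[OF aut[OF k], of v w] v by auto
      then have "w' \<in> tree d" using kiu w u(1) tree_append_iff[of "k v" w' d] by simp
      then show False using u(2) w w' kiu by (auto simp: subtree_def)
    qed
    then have "g (?i u) = ?i u" using g iu by (simp add: Rist_def)
    then show ?thesis
      using u iu kiu unfolding mult_AutT[OF aut[OF kgG] aut[OF iG]]
      unfolding mult_AutT[OF aut[OF k] aut[OF gG]] by (simp add: compose_def)
  qed
  then show ?thesis
    using subgroup.m_closed[OF G kgG iG] by (simp add: Rist_def)
qed

text \<open>Such a \<open>K\<close> contains the subgroup generated by these rigid stabilizers. This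
  serves both for the stabilizer of \<open>v\<close> and for overgroups that move
  \<open>v\<close>.\<close>

lemma branch_finite_index:
  assumes br: "branch d G" and K: "subgroup K (subgrp d G)"
    and Rist: "\<And>u. u \<in> level d n \<Longrightarrow> Rist d G u \<subseteq> K"
  shows "finite_index K (subgrp d G)"
proof -
  have G: "subgroup G (AutT d)" and fin: "finite_index (Rist_level d G n) (subgrp d G)"
    using br by (auto simp: branch_def)
  interpret G: group "subgrp d G" by (rule group.subgroup_imp_group[OF group_AutT G])
  have "subgroup (Rist_level d G n) (subgrp d G)"
    unfolding Rist_level_def by (rule G.generate_is_subgroup) (auto simp: Rist_def)
  moreover have "Rist_level d G n \<subseteq> K"
    unfolding Rist_level_def by (rule G.generate_subgroup_incl[OF _ K]) (use Rist in blast)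
  ultimately show ?thesis using G.finite_index_mono K fin by blast
qed

theorem theorem1p9:
  fixes d :: nat and G W :: "(nat list \<Rightarrow> nat list) set"
  assumes "d \<ge> 2"
    and "subgroup G (AutT d)"
    and "self_replicating d G"
    and "branch d G"
    and "weakly_maximal W (subgrp d G)"
  shows "\<forall>v\<in>tree d. \<exists>Wv. weakly_maximal Wv (subgrp d G) \<and> Wv \<subseteq> Stab d G v \<and> tree_section d Wv v = W"
proof
  fix v assume v: "v \<in> tree d"
  note G = assms(2)
  interpret A: group "AutT d" by (rule group_AutT)
  interpret G: group "subgrp d G" by (rule A.subgroup_imp_group[OF G])
  have sub: "G \<subseteq> tree_automorphisms d" using subgroup.subset[OF G] by simp
  let ?S = "Stab d G v" and ?r = "restr d v"
  have S: "subgroup ?S (subgrp d G)" by (rule subgroup_Stab[OF G v])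
  have surj: "?r ` ?S = G"
    using assms(3) v by (auto simp: self_replicating_def tree_section_def)
  have W: "subgroup W (subgrp d G)" and W_inf: "\<not> finite_index W (subgrp d G)"
    and W_max: "\<And>K. subgroup K (subgrp d G) \<Longrightarrow> \<not> finite_index K (subgrp d G) \<Longrightarrow> W \<subseteq> K \<Longrightarrow> K = W"
    using assms(5) by (auto simp: weakly_maximal_def)
  have WG: "W \<subseteq> G" using subgroup.subset[OF W] by simp
  interpret S: group "subgrp d ?S" using G.subgroup_imp_group[OF S] by simp
  \<comment> \<open>Self-replication is what makes \<open>G\<close> the codomain here, and the map
    is then onto.\<close>
  interpret r: group_hom "subgrp d ?S" "subgrp d G" ?r
  proof
    have "?r (g \<otimes>\<^bsub>AutT d\<^esub> h) = ?r g \<otimes>\<^bsub>AutT d\<^esub> ?r h" if "g \<in> ?S" "h \<in> ?S" for g h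
    proof (rule restr_mult)
      show "?r g \<in> tree_automorphisms d" "?r h \<in> tree_automorphisms d"
        using that surj sub by blast+
    qed (use that sub v in \<open>auto simp: Stab_iff\<close>)
    then show "?r \<in> hom (subgrp d ?S) (subgrp d G)"
      using surj by (auto simp: hom_def)
  qed
  define V where "V = {g \<in> ?S. ?r g \<in> W}"
  have VS: "subgroup V (subgrp d ?S)"
    unfolding V_def using r.subgroup_vimage[OF W] by simp
  then have V: "subgroup V (subgrp d G)"
    using G.incl_subgroup[OF S, of V] by simp
  \<comment> \<open>Finite index in \<open>G\<close> would give finite index in \<open>?S\<close>,
    and then \<open>W\<close> would have finite index in \<open>G\<close>.\<close>
  have V_inf: "\<not> finite_index V (subgrp d G)"
    using G.finite_index_restrict[OF S, of V] r.finite_index_vimage_iff[OF _ W] surj W_inf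
    by (auto simp: V_def)
  have one_W: "\<one>\<^bsub>AutT d\<^esub> \<in> W" using subgroup.one_closed[OF W] by simp
  have Rist_V: "Rist d G u \<subseteq> V" if "u \<in> level d (length v)" "u \<noteq> v" for u
  proof
    fix g assume g: "g \<in> Rist d G u"
    have "g v = v" "?r g = \<one>\<^bsub>AutT d\<^esub>"
      using Rist_fixes_level[OF sub g v] restr_Rist[OF g v] that by (auto simp: level_def)
    then show "g \<in> V" using g one_W by (simp add: V_def Stab_iff Rist_def)
  qed
  \<comment> \<open>Needed at the end to pass from finite index in \<open>?S\<close> to finite index
    in \<open>G\<close>.\<close>
  have S_fin: "finite_index ?S (subgrp d G)"
  proof (rule branch_finite_index[OF assms(4) S])
    fix u assume u: "u \<in> level d (length v)"
    show "Rist d G u \<subseteq> ?S"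
    proof
      fix g assume g: "g \<in> Rist d G u"
      have "g v = v" using Rist_fixes_level[OF sub g v] u by (simp add: level_def)
      then show "g \<in> ?S" using g by (simp add: Stab_iff Rist_def)
    qed
  qed
  have V_max: "K = V"
    if K: "subgroup K (subgrp d G)" "\<not> finite_index K (subgrp d G)" "V \<subseteq> K" for K
  proof -
    have KG: "K \<subseteq> G" using subgroup.subset[OF K(1)] by simp
    have KA: "subgroup K (AutT d)" by (rule A.incl_subgroup[OF G K(1)])
    have "K \<subseteq> ?S"
    proof (rule ccontr)
      assume "\<not> K \<subseteq> ?S"
      then obtain k where k: "k \<in> K" "k v \<noteq> v" using KG Stab_iff by blast
      have kG: "k \<in> G" and kA: "k \<in> tree_automorphisms d" using k KG sub by auto
      have kv: "k v \<in> level d (length v)"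
        using tree_automorphism_closed[OF kA v] tree_automorphism_length[OF kA v]
        by (simp add: level_def)
      have "Rist d G v \<subseteq> K"
      proof
        fix g assume g: "g \<in> Rist d G v"
        let ?i = "inv\<^bsub>AutT d\<^esub> k"
        have gA: "g \<in> tree_automorphisms d" using g sub by (auto simp: Rist_def)
        have i: "?i \<in> K" by (rule subgroup.m_inv_closed[OF KA k(1)])
        \<comment> \<open>The conjugate lies in the rigid stabilizer of \<open>k v\<close>, another
          vertex of the same level, hence in \<open>V\<close>; conjugating back by elements of
          \<open>K\<close> recovers \<open>g\<close>.\<close>
        have "k \<otimes>\<^bsub>AutT d\<^esub> g \<otimes>\<^bsub>AutT d\<^esub> ?i \<in> K"
          using Rist_conjugate[OF G kG v g] Rist_V[OF kv k(2)] K(3) by blast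
        then have "?i \<otimes>\<^bsub>AutT d\<^esub> (k \<otimes>\<^bsub>AutT d\<^esub> g \<otimes>\<^bsub>AutT d\<^esub> ?i) \<otimes>\<^bsub>AutT d\<^esub> k \<in> K"
          using i k(1) subgroup.m_closed[OF KA] by blast
        moreover have "?i \<otimes>\<^bsub>AutT d\<^esub> (k \<otimes>\<^bsub>AutT d\<^esub> g \<otimes>\<^bsub>AutT d\<^esub> ?i) \<otimes>\<^bsub>AutT d\<^esub> k = g"
          using kA gA by (simp add: A.inv_conj_cancel)
        ultimately show "g \<in> K" by simp
      qed
      then have "Rist d G u \<subseteq> K" if "u \<in> level d (length v)" for u
        using Rist_V[OF that] K(3) by (cases "u = v") auto
      then show False using branch_finite_index[OF assms(4) K(1)] K(2) by blast
    qed
    then have KS: "subgroup K (subgrp d ?S)"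
      using G.subgroup_incl[OF K(1) S] by simp
    have rK: "subgroup (?r ` K) (subgrp d G)" by (rule r.subgroup_img_is_subgroup[OF KS])
    \<comment> \<open>A trivial section lies in \<open>W\<close>. So \<open>K\<close> contains the
      kernel and is determined by its image.\<close>
    have "kernel (subgrp d ?S) (subgrp d G) ?r \<subseteq> V"
      using one_W by (auto simp: kernel_def V_def)
    then have K_eq: "{g \<in> ?S. ?r g \<in> ?r ` K} = K"
      using r.vimage_image_eq[OF KS] K(3) by simp
    have "\<not> finite_index (?r ` K) (subgrp d G)"
    proof
      assume "finite_index (?r ` K) (subgrp d G)"
      then have "finite_index K (subgrp d ?S)"
        using r.finite_index_vimage_iff[OF _ rK] surj K_eq by simp
      then show False
        using G.finite_index_trans[OF _ S _ S_fin, of K] KS K(2) by simp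
    qed
    moreover have "W \<subseteq> ?r ` K"
    proof
      fix w assume "w \<in> W"
      then obtain g where "g \<in> ?S" "w = ?r g" using WG surj by blast
      then show "w \<in> ?r ` K" using \<open>w \<in> W\<close> K(3) by (auto simp: V_def)
    qed
    ultimately have "?r ` K = W" by (rule W_max[OF rK])
    then show "K = V" using K_eq by (simp add: V_def)
  qed
  \<comment> \<open>Thus the section of \<open>V\<close> is the plain image \<open>?r\<close>
    followed by \<open>V\<close>, and surjectivity makes it all of \<open>W\<close>.\<close>
  have "Stab d V v = V" by (auto simp: V_def Stab_iff)
  then have "tree_section d V v = W"
    using WG surj by (force simp: tree_section_def V_def)
  moreover have "weakly_maximal V (subgrp d G)"
    using V V_inf V_max by (auto simp: weakly_maximal_def)
  moreover have "V \<subseteq> ?S" by (auto simp: V_def)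
  ultimately show "\<exists>Wv. weakly_maximal Wv (subgrp d G) \<and> Wv \<subseteq> ?S \<and> tree_section d Wv v = W"
    by blast
qed

end
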